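(* Let $n \ge 1$ be an integer such that $2n+1$ is a prime, and let $\mathcal{F}$ be the family of all minimum dominating sets of the graph $C_{2n+1}^n$ (the Cartesian product of $n$ copies of the cycle of length $2n+1$). Then every $S \in \mathcal{F}$ has a defining set (with respect to $\mathcal{F}$) of size at most $n!\,2^n$.
   Context: A set $S$ of vertices of a graph is a dominating set if every vertex either lies in $S$ or is adjacent to a vertex of $S$; a minimum dominating set is a dominating set of smallest possible size. For a family $\mathcal{F}$ of sets and $S \in \mathcal{F}$, a set $D \subseteq S$ is a defining set for $(S,\mathcal{F})$ if $S$ is the only member of $\mathcal{F}$ containing $D$. *)

theory Defs
  imports "HOL-Library.FuncSet" "HOL-Computational_Algebra.Primes"
begin

record 'a graph =
  verts :: "'a set"
  adj :: "'a \<Rightarrow> 'a \<Rightarrow> bool"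

text \<open>Residues modulo \<open>m\<close> are represented by \<open>{..<m}\<close>; this is a simple graph for \<open>m \<ge> 3\<close>.\<close>

definition cycle_graph :: "nat \<Rightarrow> nat graph" where
  "cycle_graph m =
    \<lparr>verts = {..<m},
     adj = (\<lambda>u v. u < m \<and> v < m \<and> (v = (u + 1) mod m \<or> u = (v + 1) mod m))\<rparr>"

text \<open>
  Vertices are extensional functions on the index set \<open>I\<close>, so that two vertices are equal
  iff all their coordinates agree.
\<close>

definition cartesian_product :: "'i set \<Rightarrow> ('i \<Rightarrow> 'a graph) \<Rightarrow> ('i \<Rightarrow> 'a) graph" where
  "cartesian_product I G =
    \<lparr>verts = (\<Pi>\<^sub>E i\<in>I. verts (G i)),
     adj = (\<lambda>x y. x \<in> (\<Pi>\<^sub>E i\<in>I. verts (G i)) \<and> y \<in> (\<Pi>\<^sub>E i\<in>I. verts (G i)) \<and>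
       (\<exists>i\<in>I. adj (G i) (x i) (y i) \<and> (\<forall>j\<in>I - {i}. x j = y j)))\<rparr>"

definition cartesian_power :: "'a graph \<Rightarrow> nat \<Rightarrow> (nat \<Rightarrow> 'a) graph" where
  "cartesian_power G n = cartesian_product {..<n} (\<lambda>_. G)"

definition dominating_set :: "'a graph \<Rightarrow> 'a set \<Rightarrow> bool" where
  "dominating_set G S \<longleftrightarrow>
    S \<subseteq> verts G \<and> (\<forall>v\<in>verts G. v \<in> S \<or> (\<exists>u\<in>S. adj G v u))"

text \<open>Meaningful for finite graphs only, since \<open>card\<close> is \<open>0\<close> on infinite sets.\<close>

definition min_dominating_set :: "'a graph \<Rightarrow> 'a set \<Rightarrow> bool" where
  "min_dominating_set G S \<longleftrightarrow>
    dominating_set G S \<and> (\<forall>T. dominating_set G T \<longrightarrow> card S \<le> card T)"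

definition defining_set :: "'a set set \<Rightarrow> 'a set \<Rightarrow> 'a set \<Rightarrow> bool" where
  "defining_set F S D \<longleftrightarrow> S \<in> F \<and> D \<subseteq> S \<and> (\<forall>T\<in>F. D \<subseteq> T \<longrightarrow> T = S)"

end

theory Submission
  imports Defs "HOL-Computational_Algebra.Computational_Algebra" "HOL-Number_Theory.Cong"
begin

text \<open>
  Put \<open>p = 2n + 1\<close>. A ball of radius one in the graph has \<open>p\<close> elements, and a perfect code exists,
  so the minimum dominating sets are exactly the perfect codes. Hence the difference \<open>g\<close> of the
  indicator functions of two of them sums to zero over every ball. On the Fourier side, the
  transform of \<open>g\<close> at \<open>a\<close> can only be nonzero if \<open>1 + \<Sum>\<^sub>i (\<zeta>\<^bsup>a i\<^esup> + \<zeta>\<^bsup>-a i\<^esup>) = 0\<close> for a primitive \<open>p\<close>-th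
  root of unity \<open>\<zeta>\<close>. Since \<open>1 + X + \<dots> + X\<^bsup>p-1\<^esup>\<close> is irreducible over the rationals, this holds for
  at most \<open>n! 2\<^sup>n\<close> frequencies \<open>a\<close>, namely the signed permutations of \<open>1, \<dots>, n\<close>. So \<open>g\<close> lies in
  a space of dimension at most \<open>n! 2\<^sup>n\<close>, and by linear algebra \<open>S\<close> has a subset \<open>D\<close> of at most that
  size such that \<open>g\<close> vanishes on \<open>S\<close> as soon as it vanishes on \<open>D\<close>.
\<close>

section \<open>Integer polynomials vanishing at a primitive root of unity of prime order\<close>

text \<open>Coefficients stay in the integers, where content and divisibility by \<open>p\<close>
  make sense, while roots are taken in the complex numbers.\<close>

definition poly_int :: "int poly \<Rightarrow> complex \<Rightarrow> complex" where
  "poly_int P z = poly (map_poly of_int P) z"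

lemma poly_int_0 [simp]: "poly_int 0 z = 0"
  by (simp add: poly_int_def)

lemma poly_int_pCons [simp]: "poly_int (pCons a P) z = of_int a + z * poly_int P z"
  by (cases "a = 0 \<and> P = 0") (auto simp: poly_int_def map_poly_pCons)

lemma poly_int_1 [simp]: "poly_int 1 z = 1"
  by (simp add: one_pCons)

lemma poly_int_add [simp]: "poly_int (P + Q) z = poly_int P z + poly_int Q z"
  by (induction P Q rule: poly_induct2) (simp_all add: algebra_simps)

lemma poly_int_smult [simp]: "poly_int (smult c P) z = of_int c * poly_int P z"
  by (induction P) (simp_all add: algebra_simps)

lemma poly_int_diff [simp]: "poly_int (P - Q) z = poly_int P z - poly_int Q z"
  using poly_int_add[of "P - Q" Q z] by simp

lemma poly_int_mult [simp]: "poly_int (P * Q) z = poly_int P z * poly_int Q z"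
  by (induction P) (simp_all add: algebra_simps)

lemma poly_int_prod [simp]: "poly_int (\<Prod>i\<in>A. P i) z = (\<Prod>i\<in>A. poly_int (P i) z)"
  by (induction A rule: infinite_finite_induct) simp_all

lemma poly_int_sum [simp]: "poly_int (\<Sum>i\<in>A. P i) z = (\<Sum>i\<in>A. poly_int (P i) z)"
  by (induction A rule: infinite_finite_induct) simp_all

lemma poly_int_monom [simp]: "poly_int (monom c k) z = of_int c * z ^ k"
  by (simp add: poly_int_def map_poly_monom poly_monom)

lemma poly_int_pcompose [simp]: "poly_int (pcompose P Q) z = poly_int P (poly_int Q z)"
  by (induction P) (simp_all add: pcompose_pCons)

lemma card_roots_poly_int:
  assumes "P \<noteq> 0" and "\<And>z. z \<in> Z \<Longrightarrow> poly_int P z = 0"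
  shows "card Z \<le> degree P"
proof -
  let ?P = "map_poly of_int P :: complex poly"
  have nz: "?P \<noteq> 0"
    using assms(1) by (simp add: map_poly_eq_0_iff)
  have "card Z \<le> card {z. poly ?P z = 0}"
    using assms(2) nz by (intro card_mono poly_roots_finite) (auto simp: poly_int_def)
  also have "\<dots> \<le> degree ?P"
    by (rule card_poly_roots_bound[OF nz])
  also have "degree ?P = degree P"
    by (rule degree_map_poly) auto
  finally show ?thesis .
qed

lemma poly_int_root_exists:
  assumes "degree P > 0"
  obtains z where "poly_int P z = 0"
proof -
  have "degree (map_poly of_int P :: complex poly) = degree P"
    by (rule degree_map_poly) auto
  then have "\<not> constant (poly (map_poly of_int P :: complex poly))"
    using assms by (simp add: constant_degree)
  then show ?thesis
    using fundamental_theorem_of_algebra that by (auto simp: poly_int_def)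
qed

section \<open>The geometric polynomial (for prime \<open>p\<close> the \<open>p\<close>-th
  cyclotomic polynomial) and its roots\<close>

definition geometric_poly :: "nat \<Rightarrow> int poly" where
  "geometric_poly p = (\<Sum>k<p. monom 1 k)"

lemma coeff_geometric_poly: "coeff (geometric_poly p) k = (if k < p then 1 else 0)"
  by (simp add: geometric_poly_def coeff_sum if_distrib sum.delta cong: if_cong)

lemma degree_geometric_poly: 
  assumes "p > 0"
  shows "degree (geometric_poly p) = p - 1"
proof (rule antisym)
  show "degree (geometric_poly p) \<le> p - 1"
    by (rule degree_le) (auto simp: coeff_geometric_poly)
  show "p - 1 \<le> degree (geometric_poly p)"
    using assms by (intro le_degree) (auto simp: coeff_geometric_poly)
qed

lemma poly_int_geometric_poly:
  assumes "z ^ p = 1" "z \<noteq> 1"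
  shows "poly_int (geometric_poly p) z = 0"
  using assms by (simp add: geometric_poly_def geometric_sum)

lemma poly_int_geometric_poly_eq_0D:
  assumes "poly_int (geometric_poly p) z = 0" "p > 0"
  shows "z ^ p = 1" "z \<noteq> 1"
proof -
  have eq: "(\<Sum>k<p. z ^ k) = 0"
    using assms by (simp add: geometric_poly_def)
  then show "z \<noteq> 1"
    using assms(2) by auto
  with eq show "z ^ p = 1"
    by (simp add: geometric_sum)
qed

lemma poly_geometric_poly_1: "poly (geometric_poly p) 1 = int p"
  by (simp add: geometric_poly_def poly_sum poly_monom)

lemma power_mod_root_unity:
  fixes z :: complex
  assumes "z ^ p = 1"
  shows "z ^ (k mod p) = z ^ k"
proof -
  have "z ^ k = z ^ (p * (k div p) + k mod p)"
    by simp
  also have "\<dots> = z ^ (k mod p)"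
    unfolding power_add power_mult assms by simp
  finally show ?thesis ..
qed

text \<open>Equality of two powers gives \<open>z ^ (l - k) = 1\<close> with \<open>l - k\<close>
  coprime to \<open>p\<close>; a Bezout relation then forces \<open>z = 1\<close>.\<close>

lemma prime_root_unity_inj:
  fixes z :: complex
  assumes "prime p" "z ^ p = 1" "z \<noteq> 1"
  shows "inj_on (\<lambda>k. z ^ k) {..<p}"
proof -
  have ne: "z ^ k \<noteq> z ^ l" if "k < l" "l < p" for k l
  proof
    assume "z ^ k = z ^ l"
    also have "z ^ l = z ^ k * z ^ (l - k)"
      using that by (simp flip: power_add)
    finally have 1: "z ^ (l - k) = 1"
      using assms(2) that by (auto simp: power_0_left)
    have "coprime (l - k) p"
      using that assms(1) by (metis coprime_commute dvd_imp_le not_less prime_imp_coprime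
          zero_less_diff less_imp_diff_less)
    moreover have "l - k \<noteq> 0"
      using that by simp
    ultimately obtain a b where ab: "(l - k) * a = p * b + 1"
      using bezout_nat[of "l - k" p] by (metis coprime_imp_gcd_eq_1)
    have "z = z ^ (p * b + 1)"
      using assms(2) by (simp add: power_mult)
    also have "\<dots> = 1"
      unfolding ab[symmetric] power_mult 1 by simp
    finally show False
      using assms(3) by simp
  qed
  show ?thesis
    by (rule linorder_inj_onI) (auto dest: ne)
qed

text \<open>The product of all \<open>H(X\<^sup>k)\<close> with \<open>0 < k < p\<close> vanishes at every primitive \<open>p\<close>-th root of
  unity, so it is a multiple of \<open>1 + X + \<dots> + X\<^bsup>p-1\<^esup>\<close>; evaluate both at \<open>1\<close>.\<close>

lemma prime_dvd_poly_1:
  assumes p: "prime p" and z: "z ^ p = 1" "z \<noteq> 1" and H: "poly_int H z = 0"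
  shows "int p dvd poly H 1"
proof -
  define F where "F = (\<Prod>k\<in>{1..<p}. pcompose H (monom 1 k))"
  \<comment> \<open>The divisor has leading coefficient 1, so pseudo-division is ordinary division
    with remainder.\<close>
  obtain Q R where QR: "pseudo_divmod F (geometric_poly p) = (Q, R)"
    by fastforce
  have p1: "p > 1"
    using p prime_gt_1_nat by blast
  have nz: "geometric_poly p \<noteq> 0"
    using p1 coeff_geometric_poly[of p 0] by auto
  have F: "F = geometric_poly p * Q + R"
    using pseudo_divmod(1)[OF nz QR] p1 by (simp add: degree_geometric_poly coeff_geometric_poly)
  have R: "R = 0 \<or> degree R < p - 1"
    using pseudo_divmod(2)[OF nz QR] p1 by (simp add: degree_geometric_poly)
  have F0: "poly_int F (z ^ j) = 0" if j: "j \<in> {1..<p}" for j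
  proof -
    have "coprime j p"
      using j p by (metis atLeastLessThan_iff coprime_commute dvd_imp_le not_less prime_imp_coprime
          less_le_trans zero_less_one)
    then obtain a b where ab: "j * a = p * b + 1"
      using bezout_nat[of j p] j by auto
    \<comment> \<open>\<open>k\<close> is the inverse of \<open>j\<close> modulo \<open>p\<close>,
      so the factor of \<open>F\<close> with index \<open>k\<close> takes the value
      \<open>poly_int H z = 0\<close> at \<open>z ^ j\<close>.\<close>
    define k where "k = a mod p"
    have jk: "(z ^ j) ^ k = z"
    proof -
      have "(z ^ j) ^ k = (z ^ j) ^ a"
        unfolding k_def
        by (rule power_mod_root_unity) (metis mult.commute power_mult power_one z(1))
      also have "\<dots> = z"
        unfolding power_mult[symmetric] ab using z(1) by (simp add: power_mult)
      finally show ?thesis .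
    qed
    have "k \<noteq> 0"
      using jk z(2) by (metis power_0)
    then have "k \<in> {1..<p}"
      using p1 by (auto simp: k_def)
    then show ?thesis
      unfolding F_def poly_int_prod using H jk by (intro prod_zero bexI[of _ k]) auto
  qed
  have "R = 0"
  proof (rule ccontr)
    assume "R \<noteq> 0"
    have inj: "inj_on (\<lambda>k. z ^ k) {..<p}"
      by (rule prime_root_unity_inj[OF p z])
    have "poly_int R (z ^ j) = 0" if j: "j \<in> {1..<p}" for j
    proof -
      have "(z ^ j) ^ p = 1"
        by (metis power_mult mult.commute power_one z(1))
      moreover have "z ^ j \<noteq> 1"
        using inj_onD[OF inj, of j 0] j by auto
      ultimately show ?thesis
        using F0[OF j] poly_int_geometric_poly by (simp add: F)
    qed
    then have "card ((\<lambda>k. z ^ k) ` {1..<p}) \<le> degree R"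
      using \<open>R \<noteq> 0\<close> by (intro card_roots_poly_int) auto
    moreover have "card ((\<lambda>k. z ^ k) ` {1..<p}) = p - 1"
      by (subst card_image) (auto intro: inj_on_subset[OF inj])
    ultimately show False
      using R \<open>R \<noteq> 0\<close> by simp
  qed
  have "poly H 1 ^ (p - 1) = poly F 1"
    by (simp add: F_def poly_prod poly_pcompose poly_monom)
  also have "\<dots> = int p * poly Q 1"
    by (simp add: F \<open>R = 0\<close> poly_geometric_poly_1)
  finally have "int p dvd poly H 1 ^ (p - 1)"
    by simp
  then show ?thesis
    using p by (simp add: prime_dvd_power)
qed

text \<open>Irreducibility of the geometric polynomial. An annihilator of \<open>z\<close> of
  smaller degree would give a factorisation into two nonconstant integer polynomials. Each has a
  nontrivial \<open>p\<close>-th root of unity as a root, so \<open>p\<close> divides both values at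
  1; but up to sign these multiply to \<open>p\<close>.\<close>

lemma degree_poly_int_prime_root_unity:
  assumes p: "prime p" and z: "z ^ p = 1" "z \<noteq> 1" and P: "poly_int P z = 0" "P \<noteq> 0"
  shows "p - 1 \<le> degree P"
proof (rule ccontr)
  assume less: "\<not> p - 1 \<le> degree P"
  have p1: "p > 1"
    using p prime_gt_1_nat by blast
  obtain G where G: "poly_int G z = 0" "G \<noteq> 0" 
    and Gmin: "\<And>G'. poly_int G' z = 0 \<Longrightarrow> G' \<noteq> 0 \<Longrightarrow> degree G \<le> degree G'"
    using ex_has_least_nat[of "\<lambda>G. poly_int G z = 0 \<and> G \<noteq> 0" P degree] P by blast
  obtain H R where QR: "pseudo_divmod (geometric_poly p) G = (H, R)"
    by fastforce
  define c where "c = lead_coeff G ^ (Suc (degree (geometric_poly p)) - degree G)"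
  have c: "c \<noteq> 0"
    using G by (simp add: c_def)
  have eq: "smult c (geometric_poly p) = G * H + R"
    unfolding c_def by (rule pseudo_divmod(1)[OF G(2) QR])
  have "poly_int R z = 0"
    using arg_cong[OF eq, of "\<lambda>P. poly_int P z"] G poly_int_geometric_poly[OF z] by simp
  then have "R = 0"
    using pseudo_divmod(2)[OF G(2) QR] Gmin[of R] by (meson not_less)
  \<comment> \<open>Gauss's lemma: content is multiplicative and the geometric polynomial is
    primitive, so \<open>c\<close> cancels against the contents of \<open>G\<close> and
    \<open>H\<close> up to its sign.\<close>
  define G' H' where "G' = primitive_part G" and "H' = primitive_part H"
  have cont: "content (geometric_poly p) = 1"
  proof -
    have "content (geometric_poly p) dvd coeff (geometric_poly p) 0"
      by (rule content_dvd_coeff)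
    then have "is_unit (content (geometric_poly p))"
      using p1 by (simp add: coeff_geometric_poly)
    then show ?thesis
      by (metis is_unit_normalize normalize_content)
  qed
  have "content G * content H = \<bar>c\<bar>"
    using arg_cong[OF eq, of content] by (simp add: \<open>R = 0\<close> content_mult cont)
  moreover have "smult c (geometric_poly p) = smult (content G * content H) (G' * H')"
    using eq \<open>R = 0\<close> by (metis G'_def H'_def add_0_right content_times_primitive_part
        mult_smult_left mult_smult_right smult_smult)
  ultimately have "smult c (geometric_poly p) = smult \<bar>c\<bar> (G' * H')"
    by simp
  then have "smult c (geometric_poly p) = smult c (smult (sgn c) (G' * H'))"
    by (simp add: abs_sgn)
  then have "smult c (geometric_poly p - smult (sgn c) (G' * H')) = 0"
    by (simp add: smult_diff_right)
  then have fac: "geometric_poly p = smult (sgn c) (G' * H')"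
    using c by simp
  have sgn: "sgn c \<noteq> 0"
    using c by (simp add: sgn_0_0)
  have nz: "geometric_poly p \<noteq> 0"
    using p1 coeff_geometric_poly[of p 0] by auto
  then have nz': "G' \<noteq> 0" "H' \<noteq> 0"
    using fac by auto
  have "p - 1 = degree G' + degree H'"
    using degree_geometric_poly[of p] p1 sgn nz' by (simp add: fac degree_mult_eq)
  moreover have "degree G' < p - 1"
    using Gmin[OF P] less by (simp add: G'_def)
  ultimately have "degree H' > 0"
    by simp
  then obtain y where y: "poly_int H' y = 0"
    by (rule poly_int_root_exists)
  then have "poly_int (geometric_poly p) y = 0"
    by (simp add: fac)
  then have y1: "y ^ p = 1" "y \<noteq> 1"
    using poly_int_geometric_poly_eq_0D p1 by auto
  have "of_int (content G) * poly_int G' z = 0"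
    using G(1) by (metis G'_def content_times_primitive_part poly_int_smult)
  then have "poly_int G' z = 0"
    using G(2) by simp
  then have "int p dvd poly G' 1" "int p dvd poly H' 1"
    using prime_dvd_poly_1[OF p] z y y1 by blast+
  then have "int p * int p dvd poly G' 1 * poly H' 1"
    by (rule mult_dvd_mono)
  then have "int p * int p dvd sgn c * (poly G' 1 * poly H' 1)"
    by (rule dvd_mult)
  also have "sgn c * (poly G' 1 * poly H' 1) = int p"
    using poly_geometric_poly_1[of p] by (simp add: fac)
  finally have "p * p dvd p"
    by (metis of_nat_dvd_iff of_nat_mult)
  then show False
    using p1 by (auto dest!: dvd_imp_le)
qed

text \<open>Subtracting the multiple that cancels the coefficient at \<open>p - 1\<close> leaves an
  annihilator of degree below \<open>p - 1\<close>, which must be zero.\<close>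

lemma poly_int_prime_root_unity_eq_0D:
  assumes p: "prime p" and z: "z ^ p = 1" "z \<noteq> 1"
    and P: "poly_int P z = 0" "degree P < p"
  shows "P = smult (coeff P (p - 1)) (geometric_poly p)"
proof -
  have p1: "p > 1"
    using p prime_gt_1_nat by blast
  define Q where "Q = P - smult (coeff P (p - 1)) (geometric_poly p)"
  have 0: "coeff Q i = 0" if "i \<ge> p - 1" for i
    using that P(2) p1 by (cases "i = p - 1") (auto simp: Q_def coeff_geometric_poly coeff_eq_0)
  have "Q = 0"
  proof (rule ccontr)
    assume "Q \<noteq> 0"
    have "poly_int Q z = 0"
      using P z by (simp add: Q_def poly_int_geometric_poly)
    then have "p - 1 \<le> degree Q"
      using degree_poly_int_prime_root_unity[OF p z] \<open>Q \<noteq> 0\<close> by blast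
    then show False
      using 0[of "degree Q"] \<open>Q \<noteq> 0\<close> by simp
  qed
  then show ?thesis
    by (simp add: Q_def)
qed

section \<open>The graph as a discrete torus\<close>

definition torus :: "nat \<Rightarrow> nat \<Rightarrow> (nat \<Rightarrow> nat) set" where
  "torus p n = {..<n} \<rightarrow>\<^sub>E {..<p}"

text \<open>On natural numbers the backward step along an axis is \<open>k = p - 1\<close>.\<close>

definition shift :: "nat \<Rightarrow> nat \<Rightarrow> nat \<Rightarrow> (nat \<Rightarrow> nat) \<Rightarrow> nat \<Rightarrow> nat" where
  "shift p i k x = x(i := (x i + k) mod p)"

text \<open>For \<open>p \<ge> 3\<close> this sums \<open>f\<close> over the closed neighbourhood of
  \<open>x\<close>.\<close>

definition ball_sum :: "nat \<Rightarrow> nat \<Rightarrow> ((nat \<Rightarrow> nat) \<Rightarrow> 'b) \<Rightarrow> (nat \<Rightarrow> nat) \<Rightarrow> 'b::comm_monoid_add" where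
  "ball_sum p n f x = f x + (\<Sum>i<n. f (shift p i 1 x) + f (shift p i (p - 1) x))"

lemma finite_torus [simp]: "finite (torus p n)"
  by (simp add: torus_def finite_PiE)

lemma card_torus: "card (torus p n) = p ^ n"
  by (simp add: torus_def card_funcsetE)

lemma torus_less: "x \<in> torus p n \<Longrightarrow> i < n \<Longrightarrow> x i < p"
  by (auto simp: torus_def)

lemma torus_eqI:
  assumes "x \<in> torus p n" "y \<in> torus p n" "\<And>i. i < n \<Longrightarrow> x i = y i"
  shows "x = y"
  using assms by (intro PiE_ext[of x "{..<n}" "\<lambda>_. {..<p}"]) (auto simp: torus_def)

lemma shift_in_torus:
  assumes "x \<in> torus p n" "i < n"
  shows "shift p i k x \<in> torus p n"
proof -
  have "p > 0"
    using torus_less[OF assms] by simp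
  then show ?thesis
    using assms by (auto simp: torus_def shift_def PiE_iff extensional_def)
qed

lemma shift_shift_inverse:
  assumes "x \<in> torus p n" "i < n" "k + l = p"
  shows "shift p i l (shift p i k x) = x"
proof -
  have "((x i + k) mod p + l) mod p = (x i + (k + l)) mod p"
    by (simp add: mod_simps add.assoc)
  then show ?thesis
    using torus_less[OF assms(1,2)] assms(3) by (simp add: shift_def)
qed

text \<open>Translation invariance of the sum. The two arguments of \<open>f\<close> let a shift be
  moved from one factor of a product to the other.\<close>

lemma sum_torus_shift:
  fixes f :: "(nat \<Rightarrow> nat) \<Rightarrow> (nat \<Rightarrow> nat) \<Rightarrow> 'b::comm_monoid_add"
  assumes "i < n" "k + l = p"
  shows "(\<Sum>x\<in>torus p n. f (shift p i k x) x) = (\<Sum>x\<in>torus p n. f x (shift p i l x))"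
  using assms
  by (intro sum.reindex_bij_witness[where i = "shift p i l" and j = "shift p i k"])
     (auto simp: shift_in_torus shift_shift_inverse add.commute)

text \<open>Double counting: shifts permute the torus, so each of the \<open>2 * n + 1\<close> terms
  of a ball contributes the full sum.\<close>

lemma sum_ball_sum:
  fixes f :: "(nat \<Rightarrow> nat) \<Rightarrow> nat"
  assumes "p > 0"
  shows "(\<Sum>x\<in>torus p n. ball_sum p n f x) = (2 * n + 1) * (\<Sum>x\<in>torus p n. f x)"
proof -
  have "(\<Sum>x\<in>torus p n. \<Sum>i<n. f (shift p i 1 x) + f (shift p i (p - 1) x)) =
    (\<Sum>i<n. (\<Sum>x\<in>torus p n. f (shift p i 1 x)) + (\<Sum>x\<in>torus p n. f (shift p i (p - 1) x)))"
    by (subst sum.swap) (simp add: sum.distrib)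
  also have "\<dots> = (\<Sum>i<n. 2 * (\<Sum>x\<in>torus p n. f x))"
    using assms by (intro sum.cong refl)
      (simp add: sum_torus_shift[of _ n 1 "p - 1" p "\<lambda>x _. f x", simplified]
        sum_torus_shift[of _ n "p - 1" 1 p "\<lambda>x _. f x", simplified])
  finally show ?thesis
    by (simp add: ball_sum_def sum.distrib algebra_simps)
qed

lemma ball_sum_diff:
  fixes f g :: "(nat \<Rightarrow> nat) \<Rightarrow> 'b::ab_group_add"
  shows "ball_sum p n (\<lambda>x. f x - g x) x = ball_sum p n f x - ball_sum p n g x"
  by (simp add: ball_sum_def sum.distrib sum_subtractf)

lemma ball_sum_of_nat:
  "ball_sum p n (\<lambda>x. of_nat (f x)) x = (of_nat (ball_sum p n f x) :: 'b::semiring_1)"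
  by (simp add: ball_sum_def)

section \<open>Adjacency and domination in terms of shifts and ball sums\<close>

lemma mod_add_1_eq_iff:
  fixes u v :: nat
  assumes "u < p" "v < p"
  shows "u = (v + 1) mod p \<longleftrightarrow> v = (u + (p - 1)) mod p"
proof
  assume u: "u = (v + 1) mod p"
  have "(u + (p - 1)) mod p = (v + 1 + (p - 1)) mod p"
    by (simp add: u mod_simps)
  then show "v = (u + (p - 1)) mod p"
    using assms by simp
next
  assume v: "v = (u + (p - 1)) mod p"
  have "(v + 1) mod p = (u + (p - 1) + 1) mod p"
    unfolding v by (rule mod_add_left_eq)
  then show "u = (v + 1) mod p"
    using assms by simp
qed

lemma verts_cartesian_power_cycle: "verts (cartesian_power (cycle_graph p) n) = torus p n"
  by (simp add: cartesian_power_def cartesian_product_def cycle_graph_def torus_def)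

lemma adj_cartesian_power_cycle:
  assumes x: "x \<in> torus p n"
  shows "adj (cartesian_power (cycle_graph p) n) x y \<longleftrightarrow>
    (\<exists>i<n. y = shift p i 1 x \<or> y = shift p i (p - 1) x)"
proof -
  have "adj (cartesian_power (cycle_graph p) n) x y \<longleftrightarrow> y \<in> torus p n \<and>
    (\<exists>i<n. (y i = (x i + 1) mod p \<or> x i = (y i + 1) mod p) \<and> (\<forall>j\<in>{..<n} - {i}. x j = y j))"
    using x torus_less[of x p n] torus_less[of y p n]
    by (auto simp: cartesian_power_def cartesian_product_def cycle_graph_def torus_def[symmetric])
  also have "\<dots> \<longleftrightarrow> y \<in> torus p n \<and> (\<exists>i<n. y = shift p i 1 x \<or> y = shift p i (p - 1) x)"
  proof (intro conj_cong refl ex_cong1)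
    fix i assume y: "y \<in> torus p n" and i: "i < n"
    have eq: "y = shift p i k x \<longleftrightarrow> y i = (x i + k) mod p \<and> (\<forall>j\<in>{..<n} - {i}. x j = y j)" for k
    proof
      assume "y i = (x i + k) mod p \<and> (\<forall>j\<in>{..<n} - {i}. x j = y j)"
      then show "y = shift p i k x"
        by (intro torus_eqI[OF y shift_in_torus[OF x i]]) (auto simp: shift_def)
    qed (auto simp: shift_def)
    show "(y i = (x i + 1) mod p \<or> x i = (y i + 1) mod p) \<and> (\<forall>j\<in>{..<n} - {i}. x j = y j) \<longleftrightarrow>
        y = shift p i 1 x \<or> y = shift p i (p - 1) x"
      unfolding eq using mod_add_1_eq_iff[OF torus_less[OF x i] torus_less[OF y i]] by blast
  qed
  finally show ?thesis
    using shift_in_torus[OF x] by blast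
qed

text \<open>The ball sum of the indicator of \<open>S\<close> counts the members of \<open>S\<close>
  that dominate \<open>x\<close>; this makes domination accessible to double counting.\<close>

lemma dominating_set_iff_ball_sum:
  "dominating_set (cartesian_power (cycle_graph p) n) S \<longleftrightarrow>
    S \<subseteq> torus p n \<and> (\<forall>x\<in>torus p n. ball_sum p n (\<lambda>x. if x \<in> S then 1 else 0 :: nat) x \<ge> 1)"
proof -
  have "x \<in> S \<or> (\<exists>u\<in>S. adj (cartesian_power (cycle_graph p) n) x u) \<longleftrightarrow>
    ball_sum p n (\<lambda>x. if x \<in> S then 1 else 0 :: nat) x \<ge> 1" if "x \<in> torus p n" for x
  proof -
    have "ball_sum p n (\<lambda>x. if x \<in> S then 1 else 0 :: nat) x = 0 \<longleftrightarrow>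
      x \<notin> S \<and> (\<forall>i<n. shift p i 1 x \<notin> S \<and> shift p i (p - 1) x \<notin> S)"
      by (auto simp: ball_sum_def)
    then show ?thesis
      unfolding adj_cartesian_power_cycle[OF that] by (auto simp: Suc_le_eq)
  qed
  then show ?thesis
    by (auto simp: dominating_set_def verts_cartesian_power_cycle)
qed

section \<open>Minimum dominating sets are perfect codes\<close>

text \<open>The perfect Lee code of Golomb and Welch: the possible changes of the check sum caused by
  one step are \<open>\<plusminus>1, \<dots>, \<plusminus>n\<close>, that is, all nonzero residues modulo \<open>2n + 1\<close>.\<close>

definition lee_code :: "nat \<Rightarrow> (nat \<Rightarrow> nat) set" where
  "lee_code n = {x \<in> torus (2 * n + 1) n. (\<Sum>i<n. (i + 1) * x i) mod (2 * n + 1) = 0}"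

lemma cong_checksum_shift:
  assumes "j < n"
  shows "[(\<Sum>i<n. (i + 1) * shift p j k x i) = (\<Sum>i<n. (i + 1) * x i) + (j + 1) * k] (mod p)"
proof -
  define r where "r = (\<Sum>i\<in>{..<n} - {j}. (i + 1) * x i)"
  have "(\<Sum>i<n. (i + 1) * shift p j k x i) = (j + 1) * ((x j + k) mod p) + r"
    unfolding r_def using assms
    by (subst sum.remove[of _ j]) (auto simp: shift_def intro!: sum.cong)
  also have "[\<dots> = (j + 1) * (x j + k) + r] (mod p)"
    by (intro cong_add cong_scalar_left cong_refl) (simp add: cong_def)
  also have "(j + 1) * (x j + k) + r = (\<Sum>i<n. (i + 1) * x i) + (j + 1) * k"
    unfolding r_def using assms by (subst (2) sum.remove[of _ j]) (auto simp: algebra_simps)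
  finally show ?thesis .
qed

lemma dominating_set_lee_code:
  "dominating_set (cartesian_power (cycle_graph (2 * n + 1)) n) (lee_code n)"
proof -
  define p where "p = 2 * n + 1"
  have "x \<in> lee_code n \<or> (\<exists>i<n. shift p i 1 x \<in> lee_code n \<or> shift p i (p - 1) x \<in> lee_code n)"
    if x: "x \<in> torus p n" for x
  proof -
    define s where "s = (\<Sum>i<n. (i + 1) * x i) mod p"
    have *: "shift p j k x \<in> lee_code n" if "j < n" "p dvd s + (j + 1) * k" for j k
    proof -
      have "(\<Sum>i<n. (i + 1) * shift p j k x i) mod p = (s + (j + 1) * k) mod p"
        using cong_checksum_shift[OF that(1), of p k x] by (simp add: cong_def s_def mod_simps)
      then show ?thesis
        using that shift_in_torus[OF x that(1)] by (simp add: lee_code_def p_def)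
    qed
    \<comment> \<open>Coordinate \<open>j\<close> has weight \<open>j + 1\<close>. A backward step
      in coordinate \<open>s - 1\<close> removes a small check sum \<open>s\<close>; a forward step
      in coordinate \<open>p - s - 1\<close> completes a large one to \<open>p\<close>.\<close>
    consider "s = 0" | "1 \<le> s" "s \<le> n" | "s > n"
      by linarith
    then show ?thesis
    proof cases
      case 1
      then show ?thesis
        using x by (simp add: lee_code_def s_def p_def)
    next
      case 2
      have "s + (s - 1 + 1) * (p - 1) = p * s"
        using 2 by (simp add: p_def)
      then show ?thesis
        using 2 *[of "s - 1" "p - 1"] by (intro disjI2 exI[of _ "s - 1"]) auto
    next
      case 3
      have "s < p"
        by (simp add: s_def p_def)
      then have "s + (p - s - 1 + 1) * 1 = p" "p - s - 1 < n"
        using 3 by (auto simp: p_def)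
      then show ?thesis
        using *[of "p - s - 1" 1] by (metis dvd_refl)
    qed
  qed
  moreover have "lee_code n \<subseteq> torus p n"
    by (auto simp: lee_code_def p_def)
  ultimately show ?thesis
    unfolding dominating_set_def verts_cartesian_power_cycle p_def[symmetric]
    using adj_cartesian_power_cycle[of _ p n] by metis
qed

text \<open>Coordinate 0 has weight 1, so the check sum determines it from the other
  \<open>n - 1\<close> coordinates.\<close>

lemma card_lee_code_le:
  assumes "n \<ge> 1"
  shows "card (lee_code n) \<le> (2 * n + 1) ^ (n - 1)"
proof -
  define p where "p = 2 * n + 1"
  have "inj_on (\<lambda>x. restrict x {1..<n}) (lee_code n)"
  proof (rule inj_onI)
    fix x y assume x: "x \<in> lee_code n" and y: "y \<in> lee_code n"
      and eq: "restrict x {1..<n} = restrict y {1..<n}"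
    have eq': "x i = y i" if "1 \<le> i" "i < n" for i
      using fun_cong[OF eq, of i] that by simp
    have split: "(\<Sum>i<n. (i + 1) * u i) = u 0 + (\<Sum>i\<in>{1..<n}. (i + 1) * u i)" for u :: "nat \<Rightarrow> nat"
      using assms by (simp add: lessThan_atLeast0 sum.atLeast_Suc_lessThan)
    have "[x 0 + (\<Sum>i\<in>{1..<n}. (i + 1) * x i) = y 0 + (\<Sum>i\<in>{1..<n}. (i + 1) * y i)] (mod p)"
      using x y unfolding split[symmetric] by (simp add: lee_code_def cong_def p_def)
    also have "(\<Sum>i\<in>{1..<n}. (i + 1) * y i) = (\<Sum>i\<in>{1..<n}. (i + 1) * x i)"
      using eq' by (intro sum.cong) auto
    finally have "[x 0 = y 0] (mod p)"
      by (simp add: cong_add_rcancel_nat)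
    moreover have xy: "x \<in> torus p n" "y \<in> torus p n"
      using x y by (simp_all add: lee_code_def p_def)
    then have "x 0 < p" "y 0 < p"
      using assms by (simp_all add: torus_less)
    ultimately have "x 0 = y 0"
      by (simp add: cong_def)
    then show "x = y"
      using eq' by (intro torus_eqI[OF xy]) (metis less_one not_le)
  qed
  moreover have "(\<lambda>x. restrict x {1..<n}) ` lee_code n \<subseteq> {1..<n} \<rightarrow>\<^sub>E {..<p}"
    by (rule image_subsetI) (simp add: lee_code_def torus_def p_def PiE_iff)
  ultimately have "card (lee_code n) \<le> card ({1..<n} \<rightarrow>\<^sub>E {..<p})"
    by (rule card_inj_on_le) (simp add: finite_PiE)
  then show ?thesis
    by (simp add: card_funcsetE p_def)
qed

text \<open>Comparison with the Lee code bounds \<open>card S\<close> by \<open>p ^ (n - 1)\<close>,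
  so the ball sums total at most \<open>p ^ n\<close>. Each is at least 1 and there are
  \<open>p ^ n\<close> of them, so none can exceed 1.\<close>

lemma min_dominating_set_perfect:
  assumes n: "n \<ge> 1" and S: "min_dominating_set (cartesian_power (cycle_graph (2 * n + 1)) n) S"
    and x: "x \<in> torus (2 * n + 1) n"
  shows "ball_sum (2 * n + 1) n (\<lambda>x. if x \<in> S then 1 else 0 :: nat) x = 1"
proof (rule ccontr)
  define p where "p = 2 * n + 1"
  let ?b = "ball_sum p n (\<lambda>x. if x \<in> S then 1 else 0 :: nat)"
  assume neq: "ball_sum (2 * n + 1) n (\<lambda>x. if x \<in> S then 1 else 0 :: nat) x \<noteq> 1"
  have dom: "S \<subseteq> torus p n" "\<And>x. x \<in> torus p n \<Longrightarrow> 1 \<le> ?b x"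
    using S by (auto simp: min_dominating_set_def dominating_set_iff_ball_sum p_def)
  have "card S \<le> card (lee_code n)"
    using S dominating_set_lee_code by (simp add: min_dominating_set_def)
  also have "\<dots> \<le> p ^ (n - 1)"
    using card_lee_code_le[OF n] by (simp add: p_def)
  finally have card: "card S \<le> p ^ (n - 1)" .
  have "p ^ n = (\<Sum>x\<in>torus p n. 1)"
    by (simp add: card_torus)
  also have "\<dots> < (\<Sum>x\<in>torus p n. ?b x)"
  proof (rule sum_strict_mono_ex1)
    have "?b x \<noteq> 1"
      using neq by (simp add: p_def)
    then show "\<exists>x\<in>torus p n. 1 < ?b x"
      using dom(2)[of x] x by (intro bexI[of _ x]) (auto simp: p_def)
  qed (use dom in auto)
  also have "\<dots> = p * card S"
    using dom(1) by (subst sum_ball_sum)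
      (simp_all add: p_def sum.If_cases Int_absorb1)
  also have "\<dots> \<le> p * p ^ (n - 1)"
    using card by simp
  also have "\<dots> = p ^ n"
    using n by (simp add: power_eq_if)
  finally show False
    by simp
qed

section \<open>Fourier analysis on the torus\<close>

text \<open>A character of the group \<open>(Z/p)^n\<close> when \<open>z ^ p = 1\<close>; replacing
  \<open>z\<close> by \<open>inverse z\<close> gives the inverse character.\<close>

definition character :: "complex \<Rightarrow> nat \<Rightarrow> (nat \<Rightarrow> nat) \<Rightarrow> (nat \<Rightarrow> nat) \<Rightarrow> complex" where
  "character z n a x = (\<Prod>i<n. z ^ (a i * x i))"

text \<open>The transform is unnormalised, whence the factor \<open>p ^ n\<close> in the inversion
  formula.\<close>

definition fourier :: "complex \<Rightarrow> nat \<Rightarrow> nat \<Rightarrow> ((nat \<Rightarrow> nat) \<Rightarrow> complex) \<Rightarrow> (nat \<Rightarrow> nat) \<Rightarrow> complex" where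
  "fourier z p n g a = (\<Sum>x\<in>torus p n. g x * character z n a x)"

lemma character_shift:
  assumes "z ^ p = 1" "i < n"
  shows "character z n a (shift p i k x) = character z n a x * z ^ (a i * k)"
proof -
  have "z ^ (a i * ((x i + k) mod p)) = z ^ (a i * (x i + k))"
  proof -
    have "(z ^ a i) ^ p = 1"
      by (metis assms(1) mult.commute power_mult power_one)
    then show ?thesis
      unfolding power_mult by (rule power_mod_root_unity)
  qed
  moreover have "character z n a (shift p i k x) =
      z ^ (a i * ((x i + k) mod p)) * (\<Prod>j\<in>{..<n} - {i}. z ^ (a j * x j))"
    unfolding character_def using assms
    by (subst prod.remove[of _ i]) (auto simp: shift_def intro!: prod.cong)
  moreover have "character z n a x = z ^ (a i * x i) * (\<Prod>j\<in>{..<n} - {i}. z ^ (a j * x j))"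
    unfolding character_def using assms by (subst prod.remove[of _ i]) auto
  ultimately show ?thesis
    by (simp add: algebra_simps power_add)
qed

text \<open>The sum factors over the coordinates into geometric sums of \<open>p\<close>-th roots of
  unity \<open>w i\<close>, and such a sum vanishes unless \<open>w i = 1\<close>.\<close>

lemma character_orthogonality:
  assumes p: "prime p" and z: "z ^ p = 1" "z \<noteq> 1" and x: "x \<in> torus p n" and y: "y \<in> torus p n"
  shows "(\<Sum>a\<in>torus p n. character z n a x * character (inverse z) n a y) =
    (if x = y then of_nat p ^ n else 0)"
proof -
  define w where "w i = z ^ x i * inverse z ^ y i" for i
  have z0: "z \<noteq> 0"
    using z(1) prime_gt_0_nat[OF p] by (auto simp: power_0_left)
  have w1: "w i = 1 \<longleftrightarrow> x i = y i" if i: "i < n" for i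
  proof -
    have "w i = 1 \<longleftrightarrow> z ^ x i = z ^ y i"
      using z0 by (auto simp: w_def power_inverse field_simps)
    also have "\<dots> \<longleftrightarrow> x i = y i"
      using inj_on_eq_iff[OF prime_root_unity_inj[OF p z], of "x i" "y i"]
        torus_less[OF x i] torus_less[OF y i] by simp
    finally show ?thesis .
  qed
  have wp: "w i ^ p = 1" for i
  proof -
    have "w i ^ p = (z ^ p) ^ x i * inverse (z ^ p) ^ y i"
      by (simp add: w_def power_mult_distrib power_inverse mult.commute flip: power_mult)
    then show ?thesis
      by (simp add: z)
  qed
  have "(\<Sum>a\<in>torus p n. character z n a x * character (inverse z) n a y) =
      (\<Sum>a\<in>torus p n. \<Prod>i<n. w i ^ a i)"
    by (simp add: character_def w_def power_mult_distrib mult.commute flip: prod.distrib power_mult)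
  also have "\<dots> = (\<Prod>i<n. \<Sum>k<p. w i ^ k)"
    unfolding torus_def by (rule prod_sum_PiE[symmetric]) auto
  also have "\<dots> = (\<Prod>i<n. if x i = y i then of_nat p else 0)"
  proof (intro prod.cong refl)
    fix i assume i: "i \<in> {..<n}"
    show "(\<Sum>k<p. w i ^ k) = (if x i = y i then of_nat p else 0)"
      using w1[of i] i by (cases "w i = 1") (auto simp: geometric_sum wp)
  qed
  also have "\<dots> = (if x = y then of_nat p ^ n else 0)"
  proof (cases "x = y")
    case False
    then obtain i where "i < n" "x i \<noteq> y i"
      using torus_eqI[OF x y] by blast
    then have "(\<Prod>i<n. if x i = y i then of_nat p else 0 :: complex) = 0"
      by (intro prod_zero) auto
    with False show ?thesis
      by simp
  qed simp
  finally show ?thesis .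
qed

lemma fourier_inversion:
  assumes "prime p" "z ^ p = 1" "z \<noteq> 1" "y \<in> torus p n"
  shows "of_nat p ^ n * g y = (\<Sum>a\<in>torus p n. fourier z p n g a * character (inverse z) n a y)"
proof -
  have "(\<Sum>a\<in>torus p n. fourier z p n g a * character (inverse z) n a y) =
      (\<Sum>x\<in>torus p n. g x * (\<Sum>a\<in>torus p n. character z n a x * character (inverse z) n a y))"
    unfolding fourier_def sum_distrib_right sum_distrib_left
    by (subst sum.swap) (simp add: mult.assoc)
  also have "\<dots> = (\<Sum>x\<in>torus p n. if x = y then of_nat p ^ n * g y else 0)"
    using assms by (intro sum.cong refl) (auto simp: character_orthogonality)
  also have "\<dots> = of_nat p ^ n * g y"
    using assms by simp
  finally show ?thesis ..
qed

text \<open>The exponent \<open>a i * (p - 1)\<close> stands for \<open>- a i\<close>.\<close>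

definition ball_eigenvalue :: "complex \<Rightarrow> nat \<Rightarrow> nat \<Rightarrow> (nat \<Rightarrow> nat) \<Rightarrow> complex" where
  "ball_eigenvalue z p n a = 1 + (\<Sum>i<n. z ^ a i + z ^ (a i * (p - 1)))"

text \<open>Moving each shift from \<open>g\<close> onto the character multiplies by a power of
  \<open>z\<close>: the characters diagonalise the ball-sum operator.\<close>

lemma fourier_ball_sum:
  assumes "z ^ p = 1" "p > 0"
  shows "fourier z p n (ball_sum p n g) a = fourier z p n g a * ball_eigenvalue z p n a"
proof -
  have *: "(\<Sum>x\<in>torus p n. g (shift p i k x) * character z n a x) = fourier z p n g a * z ^ (a i * l)"
    if "i < n" "k + l = p" for i k l
  proof -
    have "(\<Sum>x\<in>torus p n. g (shift p i k x) * character z n a x) =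
        (\<Sum>x\<in>torus p n. g x * character z n a (shift p i l x))"
      by (rule sum_torus_shift[OF that])
    then show ?thesis
      using that(1) by (simp add: character_shift[OF assms(1)] fourier_def sum_distrib_right mult.assoc)
  qed
  have "fourier z p n (ball_sum p n g) a = fourier z p n g a +
      (\<Sum>i<n. (\<Sum>x\<in>torus p n. g (shift p i 1 x) * character z n a x) +
        (\<Sum>x\<in>torus p n. g (shift p i (p - 1) x) * character z n a x))"
    unfolding fourier_def ball_sum_def
    by (simp add: distrib_right sum.distrib sum_distrib_right)
       (simp add: sum.swap[of _ "{..<n}"])
  also have "\<dots> = fourier z p n g a * ball_eigenvalue z p n a"
    using assms(2) *[of _ 1 "p - 1"] *[of _ "p - 1" 1]
    by (simp add: ball_eigenvalue_def distrib_left sum_distrib_left sum.distrib add.commute)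
  finally show ?thesis .
qed

text \<open>A vanishing eigenvalue is a vanishing sum of \<open>p\<close> roots of unity, so the exponents
  \<open>0, \<plusminus>a\<^sub>0, \<dots>, \<plusminus>a\<^sub>n\<^sub>-\<^sub>1\<close> run through every residue exactly once: \<open>a\<close> is a signed permutation
  of \<open>1, \<dots>, n\<close>.\<close>

lemma card_ball_eigenvalue_eq_0:
  fixes n :: nat
  defines "p \<equiv> 2 * n + 1"
  assumes p: "prime p" and z: "z ^ p = 1" "z \<noteq> 1"
  shows "card {a \<in> torus p n. ball_eigenvalue z p n a = 0} \<le> fact n * 2 ^ n"
proof -
  define A where "A = {a \<in> torus p n. ball_eigenvalue z p n a = 0}"
  \<comment> \<open>The distance of \<open>a i\<close> from 0 modulo \<open>p\<close>: the
    permutation underlying a signed permutation.\<close>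
  define abs_val where "abs_val a = (\<lambda>i\<in>{..<n}. min (a i) (p - a i))" for a :: "nat \<Rightarrow> nat"
  have p0: "p > 0"
    by (simp add: p_def)
  have inj: "abs_val a \<in> {f \<in> {..<n} \<rightarrow>\<^sub>E {1..n}. inj_on f {..<n}}" if "a \<in> A" for a
  proof -
    have a: "a i < p" if "i < n" for i
      using \<open>a \<in> A\<close> torus_less that by (auto simp: A_def)
    \<comment> \<open>\<open>P\<close> counts how often each residue occurs among 0 and the
      \<open>a i\<close> and \<open>- a i\<close>; reducing the exponents keeps the degree below
      \<open>p\<close>.\<close>
    define P where "P = (1 :: int poly) + (\<Sum>i<n. monom 1 (a i) + monom 1 (a i * (p - 1) mod p))"
    have "poly_int P z = ball_eigenvalue z p n a"
      by (simp add: P_def ball_eigenvalue_def power_mod_root_unity[OF z(1)])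
    then have "poly_int P z = 0"
      using \<open>a \<in> A\<close> by (simp add: A_def)
    moreover have "degree P < p"
      unfolding P_def using a p0
      by (intro degree_add_less degree_sum_less) (auto simp: degree_monom_eq)
    ultimately obtain c where c: "P = smult c (geometric_poly p)"
      using poly_int_prime_root_unity_eq_0D[OF p z] by blast
    \<comment> \<open>There are \<open>2 * n + 1 = p\<close> exponents in all, which fixes the
      scalar \<open>c\<close>.\<close>
    have "poly P 1 = int p"
      by (simp add: P_def poly_sum poly_monom p_def)
    then have "c = 1"
      using p0 by (simp add: c poly_geometric_poly_1)
    have one: "(if j = 0 then 1 else 0) + 
        (\<Sum>i<n. (if a i = j then 1 else 0) + (if a i * (p - 1) mod p = j then 1 else 0)) = (1::int)"
      if "j < p" for j
      using arg_cong[OF c, of "\<lambda>P. coeff P j"] that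
      by (simp add: \<open>c = 1\<close> P_def coeff_sum coeff_geometric_poly one_pCons coeff_pCons split: nat.splits)
    define t where "t i j = (if a i = j then 1 else 0) +
      (if a i * (p - 1) mod p = j then 1 else 0 :: int)" for i j
    have t0: "t i j \<ge> 0" for i j
      by (simp add: t_def)
    have one: "(if j = 0 then 1 else 0) + (\<Sum>i<n. t i j) = 1" if "j < p" for j
      using one[OF that] by (simp only: t_def)
    \<comment> \<open>Residue 0 is already used up by the constant term 1 of
      \<open>P\<close>.\<close>
    have pos: "a i > 0" if i: "i < n" for i
    proof (rule ccontr)
      assume "\<not> a i > 0"
      then have "t i 0 > 0"
        by (simp add: t_def)
      moreover have "t i 0 \<le> (\<Sum>i<n. t i 0)"
        using i t0 by (intro member_le_sum) auto
      ultimately show False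
        using one[OF p0] by simp
    qed
    have neg: "a i * (p - 1) mod p = p - a i" if i: "i < n" for i
    proof -
      have "a i * (p - 1) = (p - a i) + p * (a i - 1)"
        using a[OF i] pos[OF i] by (cases "a i") (auto simp: algebra_simps)
      also have "\<dots> mod p = p - a i"
        using pos[OF i] p0 by simp
      finally show ?thesis .
    qed
    have "inj_on (abs_val a) {..<n}"
    proof (rule inj_onI)
      fix i k assume ik: "i \<in> {..<n}" "k \<in> {..<n}" and eq: "abs_val a i = abs_val a k"
      show "i = k"
      proof (rule ccontr)
        assume "i \<noteq> k"
        have "a k = a i \<or> p - a k = a i"
          using eq ik a[of i] a[of k] by (auto simp: abs_val_def min_def split: if_splits)
        \<comment> \<open>Equal distances would make the residue \<open>a i\<close> occur twice,
          once from each index.\<close>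
        then have "t k (a i) \<ge> 1" "t i (a i) \<ge> 1"
          using ik neg[of k] by (auto simp: t_def)
        moreover have "(\<Sum>j\<in>{i, k}. t j (a i)) \<le> (\<Sum>j<n. t j (a i))"
          using ik t0 by (intro sum_mono2) auto
        ultimately have "(\<Sum>j<n. t j (a i)) \<ge> 2"
          using \<open>i \<noteq> k\<close> by simp
        then show False
          using one[OF a, of i] ik by (simp split: if_splits)
      qed
    qed
    moreover have "abs_val a i \<in> {1..n}" if "i < n" for i
      using a[OF that] pos[OF that] that by (auto simp: abs_val_def p_def min_def)
    moreover have "abs_val a \<in> extensional {..<n}"
      by (simp add: abs_val_def)
    ultimately show ?thesis
      by (simp add: PiE_iff)
  qed
  \<comment> \<open>Only the sign of each coordinate is lost in \<open>abs_val\<close>; whether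
    \<open>a i \<le> n\<close> restores it, since \<open>p = 2 * n + 1\<close>.\<close>
  have "inj_on (\<lambda>a. (abs_val a, {i \<in> {..<n}. a i \<le> n})) A"
  proof (rule inj_onI)
    fix a b assume a: "a \<in> A" and b: "b \<in> A" 
      and eq: "(abs_val a, {i \<in> {..<n}. a i \<le> n}) = (abs_val b, {i \<in> {..<n}. b i \<le> n})"
    show "a = b"
    proof (rule torus_eqI)
      fix i assume i: "i < n"
      have "abs_val a i = abs_val b i"
        using eq by simp
      then have "min (a i) (p - a i) = min (b i) (p - b i)"
        using i by (simp add: abs_val_def)
      moreover have "a i \<le> n \<longleftrightarrow> b i \<le> n"
        using eq i by auto
      moreover have "a i < p" "b i < p"
        using a b i torus_less by (auto simp: A_def)
      ultimately show "a i = b i"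
        by (auto simp: p_def min_def split: if_splits)
    qed (use a b in \<open>auto simp: A_def\<close>)
  qed
  moreover have "(\<lambda>a. (abs_val a, {i \<in> {..<n}. a i \<le> n})) ` A \<subseteq>
      {f \<in> {..<n} \<rightarrow>\<^sub>E {1..n}. inj_on f {..<n}} \<times> Pow {..<n}"
    using inj by blast
  ultimately have "card A \<le> card ({f \<in> {..<n} \<rightarrow>\<^sub>E {1..n}. inj_on f {..<n}} \<times> Pow {..<n})"
    by (rule card_inj_on_le) (auto simp: finite_PiE)
  also have "\<dots> = fact n * 2 ^ n"
    by (simp add: card_cartesian_product card_inj_on_subset_funcset card_Pow fact_prod_rev)
  finally show ?thesis
    by (simp add: A_def)
qed

section \<open>Defining sets\<close>

text \<open>Row rank is at most the number of columns: Gaussian elimination by induction on the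
  columns \<open>A\<close>. \<open>finite D\<close> makes the bound meaningful, as
  \<open>card\<close> of an infinite set is 0.\<close>

lemma exists_small_determining_subset:
  fixes v :: "'s \<Rightarrow> 'a \<Rightarrow> 'k::field"
  assumes "finite A"
  shows "\<exists>D\<subseteq>S. card D \<le> card A \<and> finite D \<and>
    (\<forall>c. (\<forall>s\<in>D. (\<Sum>a\<in>A. c a * v s a) = 0) \<longrightarrow> (\<forall>s\<in>S. (\<Sum>a\<in>A. c a * v s a) = 0))"
  using assms
proof (induction A arbitrary: v rule: finite_induct)
  case empty
  show ?case
    by (intro exI[of _ "{}"]) auto
next
  case (insert a A)
  show ?case
  proof (cases "\<forall>s\<in>S. v s a = 0")
    case True
    obtain D where D: "D \<subseteq> S" "card D \<le> card A" "finite D" and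
      *: "\<And>c. \<forall>s\<in>D. (\<Sum>a\<in>A. c a * v s a) = 0 \<Longrightarrow> \<forall>s\<in>S. (\<Sum>a\<in>A. c a * v s a) = 0"
      using insert.IH[of v] by blast
    have eq: "(\<Sum>a\<in>insert a A. c a * v s a) = (\<Sum>a\<in>A. c a * v s a)" if "s \<in> S" for s c
      using insert.hyps True that by simp
    have "\<forall>s\<in>S. (\<Sum>a\<in>insert a A. c a * v s a) = 0"
      if "\<forall>s\<in>D. (\<Sum>a\<in>insert a A. c a * v s a) = 0" for c
      using *[of c] that eq D(1) by (metis subsetD)
    moreover have "card D \<le> card (insert a A)"
      using D(2) insert.hyps by simp
    ultimately show ?thesis
      using D by blast
  next
    case False
    then obtain t where t: "t \<in> S" "v t a \<noteq> 0"
      by blast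
    \<comment> \<open>With pivot row \<open>t\<close>, column \<open>a\<close> is cleared from every
      row; once the sum for row \<open>t\<close> vanishes, the sums for \<open>w\<close> and
      \<open>v\<close> agree.\<close>
    define w where "w s b = v s b - v s a / v t a * v t b" for s b
    obtain D where D: "D \<subseteq> S" "card D \<le> card A" "finite D" and
      *: "\<And>c. \<forall>s\<in>D. (\<Sum>a\<in>A. c a * w s a) = 0 \<Longrightarrow> \<forall>s\<in>S. (\<Sum>a\<in>A. c a * w s a) = 0"
      using insert.IH[of w] by blast
    have w: "(\<Sum>b\<in>A. c b * w s b) = 
        (\<Sum>b\<in>insert a A. c b * v s b) - v s a / v t a * (\<Sum>b\<in>insert a A. c b * v t b)" for s c
    proof -
      have "(\<Sum>b\<in>insert a A. c b * v s b) - v s a / v t a * (\<Sum>b\<in>insert a A. c b * v t b) =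
          (\<Sum>b\<in>insert a A. c b * w s b)"
        by (simp add: w_def sum_distrib_left sum_subtractf algebra_simps del: sum.insert)
      also have "\<dots> = (\<Sum>b\<in>A. c b * w s b)"
        using insert.hyps t by (simp add: w_def)
      finally show ?thesis ..
    qed
    have "\<forall>s\<in>S. (\<Sum>b\<in>insert a A. c b * v s b) = 0"
      if "\<forall>s\<in>insert t D. (\<Sum>b\<in>insert a A. c b * v s b) = 0" for c
      using *[of c] that unfolding w by simp
    moreover have "card (insert t D) \<le> card (insert a A)"
      using D insert.hyps by (simp add: card_insert_if)
    moreover have "insert t D \<subseteq> S" "finite (insert t D)"
      using D t by simp_all
    ultimately show ?thesis
      by blast
  qed
qed

lemma exists_prime_root_unity:
  assumes "p > 1"
  obtains z :: complex where "z ^ p = 1" "z \<noteq> 1"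
proof -
  have "card {z :: complex. z ^ p = 1} = p"
    using assms by (intro card_roots_unity_eq) simp
  then have "\<not> {z :: complex. z ^ p = 1} \<subseteq> {1}"
    using assms card_mono[of "{1 :: complex}" "{z. z ^ p = 1}"] by auto
  then show ?thesis
    using that by blast
qed

theorem theorem2:
  fixes n :: nat and F :: "(nat \<Rightarrow> nat) set set"
  assumes "n \<ge> 1"
    and "prime (2 * n + 1)"
    and "F = {S. min_dominating_set (cartesian_power (cycle_graph (2 * n + 1)) n) S}"
  shows "\<forall>S\<in>F. \<exists>D. defining_set F S D \<and> card D \<le> fact n * 2 ^ n"
proof
  fix S assume "S \<in> F"
  define p where "p = 2 * n + 1"
  have p: "prime p" "p > 0"
    using assms(2) by (simp_all add: p_def)
  obtain z :: complex where z: "z ^ p = 1" "z \<noteq> 1"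
    by (rule exists_prime_root_unity[OF prime_gt_1_nat[OF p(1)]])
  define A where "A = {a \<in> torus p n. ball_eigenvalue z p n a = 0}"
  have "finite A"
    by (simp add: A_def)
  \<comment> \<open>\<open>D\<close> is fixed before any competitor \<open>T\<close> is considered;
    the inverse characters are those of the inversion formula.\<close>
  from exists_small_determining_subset[OF this, of S "\<lambda>x a. character (inverse z) n a x"]
  obtain D where D: "D \<subseteq> S" "card D \<le> card A" and det:
      "\<forall>c. (\<forall>x\<in>D. (\<Sum>a\<in>A. c a * character (inverse z) n a x) = 0) \<longrightarrow>
        (\<forall>x\<in>S. (\<Sum>a\<in>A. c a * character (inverse z) n a x) = 0)"
    by (elim exE conjE) (rule that)
  have "T = S" if "T \<in> F" "D \<subseteq> T" for T
  proof -
    have min: "min_dominating_set (cartesian_power (cycle_graph p) n) S"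
      "min_dominating_set (cartesian_power (cycle_graph p) n) T"
      using \<open>S \<in> F\<close> \<open>T \<in> F\<close> by (simp_all add: assms(3) p_def)
    then have sub: "S \<subseteq> torus p n" "T \<subseteq> torus p n"
      by (auto simp: min_dominating_set_def dominating_set_def verts_cartesian_power_cycle)
    have card: "card S = card T"
      using min unfolding min_dominating_set_def by (metis order_antisym)
    define ind :: "(nat \<Rightarrow> nat) set \<Rightarrow> (nat \<Rightarrow> nat) \<Rightarrow> nat"
      where "ind X = (\<lambda>x. if x \<in> X then 1 else 0)" for X
    define g :: "(nat \<Rightarrow> nat) \<Rightarrow> complex" where "g = (\<lambda>x. of_nat (ind S x) - of_nat (ind T x))"
    have "ball_sum p n g x = 0" if "x \<in> torus p n" for x
      using min_dominating_set_perfect[OF assms(1), of _ x] min that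
      by (simp add: g_def ball_sum_diff ball_sum_of_nat ind_def p_def)
    then have "fourier z p n (ball_sum p n g) a = 0" for a
      by (simp add: fourier_def)
    \<comment> \<open>Outside \<open>A\<close> the eigenvalue is nonzero, so the coefficient of
      \<open>g\<close> must vanish.\<close>
    then have supp: "fourier z p n g a = 0" if "a \<in> torus p n - A" for a
      using that by (auto simp: fourier_ball_sum[OF z(1) p(2)] A_def)
    have g: "of_nat p ^ n * g x = (\<Sum>a\<in>A. fourier z p n g a * character (inverse z) n a x)"
      if "x \<in> S" for x
    proof -
      have x: "x \<in> torus p n"
        using that sub by blast
      show ?thesis
        unfolding fourier_inversion[OF p(1) z x, of g]
        by (intro sum.mono_neutral_right) (auto simp: A_def supp[unfolded A_def])
    qed
    \<comment> \<open>\<open>D\<close> lies in both \<open>S\<close> and \<open>T\<close>, so both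
      indicators are 1 there; \<open>det\<close> then spreads the vanishing of \<open>g\<close> to
      all of \<open>S\<close>.\<close>
    have "g x = 0" if "x \<in> D" for x
      using that D(1) \<open>D \<subseteq> T\<close> by (auto simp: g_def ind_def)
    then have "\<forall>x\<in>D. (\<Sum>a\<in>A. fourier z p n g a * character (inverse z) n a x) = 0"
      using g D(1) by (metis mult_zero_right subsetD)
    then have "of_nat p ^ n * g x = 0" if "x \<in> S" for x
      using det[rule_format, of "fourier z p n g"] g that by simp
    then have g0: "g x = 0" if "x \<in> S" for x
      using that p(2) by simp
    have "x \<in> T" if "x \<in> S" for x
      using g0[OF that] that by (simp add: g_def ind_def split: if_splits)
    \<comment> \<open>Vanishing on \<open>S\<close> alone yields only an inclusion; equal
      cardinality of minimum dominating sets turns it into equality.\<close>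
    then have "S \<subseteq> T"
      by blast
    moreover have "finite T"
      using sub finite_subset by fastforce
    ultimately show "T = S"
      using card by (metis card_subset_eq)
  qed
  moreover have "card D \<le> fact n * 2 ^ n"
    using D(2) card_ball_eigenvalue_eq_0[of n z] p(1) z unfolding A_def p_def by linarith
  ultimately show "\<exists>D. defining_set F S D \<and> card D \<le> fact n * 2 ^ n"
    using D(1) \<open>S \<in> F\<close> unfolding defining_set_def by blast
qed

end
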